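(* Let $t\geq 4$ and let $G$ be a connected $(P_5,K_t^h)$-free graph. Then $rvc(G)\leq diam(G)+t$.
   Context: All graphs are simple, finite, undirected. For a graph $G$ with a vertex-coloring (adjacent vertices may share colors), a path is vertex-rainbow if its internal vertices have pairwise distinct colors; $G$ is rainbow vertex-connected if every two distinct vertices are joined by a vertex-rainbow path. For a connected graph $G$, $rvc(G)$ is the minimum number of colors in a vertex-coloring making $G$ rainbow vertex-connected (complete graphs have $rvc=0$). $diam(G)$ is the diameter. $P_5$ is the path on 5 vertices. $K_t^h$ is the graph obtained from $K_t$ by attaching a pendant edge to each vertex. $G$ is $(X,Y)$-free if it has no induced subgraph isomorphic to $X$ or $Y$. *)

theory Defs
  imports "Graph_Theory.Graph_Theory"
begin

text \<open>
  Finite simple undirected graphs are the library's locale \<^locale>\<open>graph\<close>: finite, loop-free,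
  symmetric digraphs without parallel arcs. The adjacency relation is \<^const>\<open>arcs_ends\<close>.
\<close>

subsection \<open>Distance and diameter\<close>

definition joins :: "('a, 'b) pre_digraph \<Rightarrow> 'a \<Rightarrow> 'a list \<Rightarrow> 'a \<Rightarrow> bool" where
  "joins G u p v \<longleftrightarrow> vpath p G \<and> hd p = u \<and> last p = v"

(* Meaningful only for connected graphs: if no path joins u and v, LEAST is unspecified. *)
definition graph_dist :: "('a, 'b) pre_digraph \<Rightarrow> 'a \<Rightarrow> 'a \<Rightarrow> nat" where
  "graph_dist G u v = (LEAST n. \<exists>p. joins G u p v \<and> vwalk_length p = n)"

definition diam :: "('a, 'b) pre_digraph \<Rightarrow> nat" where
  "diam G = Max {graph_dist G u v | u v. u \<in> verts G \<and> v \<in> verts G}"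

subsection \<open>Rainbow vertex-connection\<close>

(* butlast (tl p) lists the internal vertices of p. *)
definition vertex_rainbow :: "('a \<Rightarrow> 'c) \<Rightarrow> 'a list \<Rightarrow> bool" where
  "vertex_rainbow c p \<longleftrightarrow> distinct (map c (butlast (tl p)))"

definition rainbow_vertex_connected :: "('a, 'b) pre_digraph \<Rightarrow> ('a \<Rightarrow> 'c) \<Rightarrow> bool" where
  "rainbow_vertex_connected G c \<longleftrightarrow>
    (\<forall>u \<in> verts G. \<forall>v \<in> verts G. u \<noteq> v \<longrightarrow> (\<exists>p. joins G u p v \<and> vertex_rainbow c p))"

(* Every colouring of a nonempty graph uses a colour, so the value 0 on complete graphs
   is a convention that has to be imposed separately. *)
definition rvc :: "('a, 'b) pre_digraph \<Rightarrow> nat" where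
  "rvc G = (if K\<^bsub>card (verts G)\<^esub> G then 0
    else LEAST k. \<exists>c :: 'a \<Rightarrow> nat. card (c ` verts G) = k \<and> rainbow_vertex_connected G c)"

subsection \<open>Forbidden induced subgraphs\<close>

definition free_of :: "('c, 'd) pre_digraph \<Rightarrow> ('a, 'b) pre_digraph \<Rightarrow> bool" where
  "free_of X G \<longleftrightarrow> \<not> (\<exists>H. induced_subgraph H G \<and> digraph_iso H X)"

definition path_graph :: "nat \<Rightarrow> nat pair_pre_digraph" where
  "path_graph n = \<lparr> pverts = {..<n},
     parcs = {(i, j). i < n \<and> j < n \<and> (j = Suc i \<or> i = Suc j)} \<rparr>"

(* K_t with a pendant edge at each vertex: Inl i are the clique vertices, Inr i is the leaf at Inl i. *)
definition complete_pendant_graph :: "nat \<Rightarrow> (nat + nat) pair_pre_digraph" where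
  "complete_pendant_graph t = \<lparr> pverts = {..<t} <+> {..<t},
     parcs = {(Inl i, Inl j) | i j. i < t \<and> j < t \<and> i \<noteq> j}
       \<union> (\<Union>i<t. {(Inl i, Inr i), (Inr i, Inl i)}) \<rparr>"

lemma pair_graph_path_graph: "pair_graph (path_graph n)"
proof -
  have "finite {(i, j). i < n \<and> j < n \<and> (j = Suc i \<or> i = Suc j)}"
    by (rule finite_subset[of _ "{..<n} \<times> {..<n}"]) auto
  then show ?thesis
    by unfold_locales (auto simp: path_graph_def symmetric_def sym_def)
qed

lemma pair_graph_complete_pendant_graph: "pair_graph (complete_pendant_graph t)"
proof -
  have "finite {(Inl i :: nat + nat, Inl j :: nat + nat) | i j. i < t \<and> j < t \<and> i \<noteq> j}"
    by (rule finite_subset[of _ "({..<t} <+> {..<t}) \<times> ({..<t} <+> {..<t})"]) auto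
  then show ?thesis
    by unfold_locales (auto simp: complete_pendant_graph_def symmetric_def sym_def)
qed

subsection \<open>The extremal operators are attained on connected graphs\<close>

lemma connected_joins:
  assumes "graph G" "connected G" "u \<in> verts G" "v \<in> verts G"
  shows "\<exists>p. joins G u p v"
proof -
  interpret graph G by fact
  have "strongly_connected G"
    using symmetric_connected_imp_strongly_connected assms(2) sym_arcs by blast
  then have "u \<rightarrow>\<^sup>*\<^bsub>G\<^esub> v"
    using assms(3,4) by (auto simp: strongly_connected_def)
  then show ?thesis
    unfolding joins_def reachable_vpath_conv by blast
qed

lemma graph_dist_attained:
  assumes "graph G" "connected G" "u \<in> verts G" "v \<in> verts G"
  shows "\<exists>p. joins G u p v \<and> vwalk_length p = graph_dist G u v"
proof -
  have "\<exists>n p. joins G u p v \<and> vwalk_length p = n"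
    using connected_joins[OF assms] by blast
  then show ?thesis
    unfolding graph_dist_def by (rule LeastI_ex)
qed

lemma diam_attained:
  assumes "graph G" "connected G"
  shows "\<exists>u \<in> verts G. \<exists>v \<in> verts G. graph_dist G u v = diam G"
    and "u \<in> verts G \<Longrightarrow> v \<in> verts G \<Longrightarrow> graph_dist G u v \<le> diam G"
proof -
  interpret graph G by fact
  let ?D = "{graph_dist G u v | u v. u \<in> verts G \<and> v \<in> verts G}"
  have "?D = (\<lambda>(u, v). graph_dist G u v) ` (verts G \<times> verts G)"
    by auto
  then have fin: "finite ?D"
    by simp
  obtain w where "w \<in> verts G"
    using assms(2) by (auto simp: connected_def strongly_connected_def mk_symmetric_def)
  then have "?D \<noteq> {}"
    by blast
  then have "diam G \<in> ?D"
    unfolding diam_def using fin by (rule Max_in[rotated])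
  then show "\<exists>u \<in> verts G. \<exists>v \<in> verts G. graph_dist G u v = diam G"
    by force
  show "graph_dist G u v \<le> diam G" if "u \<in> verts G" "v \<in> verts G"
    unfolding diam_def using fin that by (intro Max_ge) auto
qed

lemma rvc_attained:
  fixes G :: "('a, 'b) pre_digraph"
  assumes "graph G" "connected G" "\<not> K\<^bsub>card (verts G)\<^esub> G"
  shows "\<exists>c :: 'a \<Rightarrow> nat. card (c ` verts G) = rvc G \<and> rainbow_vertex_connected G c"
proof -
  interpret graph G by fact
  obtain c :: "'a \<Rightarrow> nat" where inj: "inj_on c (verts G)"
    using finite_imp_inj_to_nat_seg[OF finite_verts] by blast
  have "rainbow_vertex_connected G c"
    unfolding rainbow_vertex_connected_def
  proof (intro ballI impI)
    fix u v assume "u \<in> verts G" "v \<in> verts G"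
    then obtain p where p: "joins G u p v"
      using connected_joins[OF assms(1,2)] by metis
    then have verts: "set p \<subseteq> verts G" and dist: "distinct p"
      by (simp_all add: joins_def vpath_def vwalk_def)
    have "set (butlast (tl p)) \<subseteq> set p"
      by (cases p) (auto dest: in_set_butlastD)
    then have "inj_on c (set (butlast (tl p)))"
      using inj verts by (meson inj_on_subset subset_trans)
    then have "vertex_rainbow c p"
      unfolding vertex_rainbow_def distinct_map using dist by (simp add: distinct_butlast distinct_tl)
    with p show "\<exists>p. joins G u p v \<and> vertex_rainbow c p"
      by blast
  qed
  then have "\<exists>k. \<exists>c :: 'a \<Rightarrow> nat. card (c ` verts G) = k \<and> rainbow_vertex_connected G c"
    by blast
  then have "\<exists>c :: 'a \<Rightarrow> nat. card (c ` verts G)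
      = (LEAST k. \<exists>c :: 'a \<Rightarrow> nat. card (c ` verts G) = k \<and> rainbow_vertex_connected G c)
      \<and> rainbow_vertex_connected G c"
    by (rule LeastI_ex)
  then show ?thesis
    using assms(3) by (simp add: rvc_def)
qed

end

theory Submission
  imports Defs
begin

text \<open>
  A connected \<open>P\<^sub>5\<close>-free graph has a dominating clique or a dominating path on four vertices (a weak
  form of a theorem of Bacso and Tuza). A dominating path needs four colours. For a dominating
  clique \<open>K\<close> of least size, every vertex of \<open>K\<close> has a private neighbour outside \<open>K\<close>. If \<open>u\<close> and \<open>v\<close>
  are at distance three, then \<open>P\<^sub>5\<close>-freeness makes the private neighbours of the vertices of \<open>K\<close>
  adjacent to neither \<open>u\<close> nor \<open>v\<close> pairwise nonadjacent, so there are fewer than \<open>t\<close> such vertices.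
  Giving \<open>t\<close> vertices of \<open>K\<close> distinct colours and all others one further colour therefore puts two
  colours among the neighbours of \<open>u\<close> and \<open>v\<close> in \<open>K\<close>, which yields a rainbow path through \<open>K\<close>. Thus
  \<open>t + 1\<close> colours suffice.
\<close>

section \<open>Connected P5-free graphs as symmetric relations\<close>

text \<open>A plain adjacency relation keeps the combinatorics free of arcs and walks. Connectedness
  takes the form in which it is applied: a nonempty set closed under adjacency is
  everything.\<close>

locale connected_P5_free =
  fixes V :: "'a set" and E :: "'a \<Rightarrow> 'a \<Rightarrow> bool"
  assumes finite_V: "finite V"
    and nonempty_V: "V \<noteq> {}"
    and sym: "E x y \<Longrightarrow> E y x"
    and irrefl: "\<not> E x x"
    and E_in_V: "E x y \<Longrightarrow> x \<in> V \<and> y \<in> V"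
    and closed_eq_V: "\<lbrakk>S \<subseteq> V; S \<noteq> {}; \<And>x y. x \<in> S \<Longrightarrow> E x y \<Longrightarrow> y \<in> S\<rbrakk> \<Longrightarrow> S = V"
    \<comment> \<open>distinctness of the five vertices follows from the pattern of edges and non-edges\<close>
    and no_P5: "\<lbrakk>E a b; E b c; E c d; E d e\<rbrakk> \<Longrightarrow> E a c \<or> E a d \<or> E a e \<or> E b d \<or> E b e \<or> E c e"
begin

definition clique :: "'a set \<Rightarrow> bool" where
  "clique K \<longleftrightarrow> K \<subseteq> V \<and> K \<noteq> {} \<and> (\<forall>x\<in>K. \<forall>y\<in>K. x \<noteq> y \<longrightarrow> E x y)"

definition dom :: "'a set \<Rightarrow> 'a set" where
  "dom X = {x \<in> V. x \<in> X \<or> (\<exists>k\<in>X. E k x)}"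

lemma E_commute: "E x y \<longleftrightarrow> E y x"
  using sym by blast

lemma cliqueD: "clique K \<Longrightarrow> x \<in> K \<Longrightarrow> y \<in> K \<Longrightarrow> x \<noteq> y \<Longrightarrow> E x y"
  by (simp add: clique_def)

section \<open>Existence of a dominating clique or a dominating four-vertex path\<close>

text \<open>
  Take a clique \<open>K\<close> dominating as many vertices as possible, and let \<open>w\<close> be a neighbour of \<open>K\<close> with as
  many undominated neighbours as possible. If some undominated \<open>y\<close> is not adjacent to \<open>w\<close>, it has a
  neighbour \<open>q\<close> with the same neighbours in \<open>K\<close> as \<open>w\<close>, and \<open>w\<close>, \<open>q\<close> and these neighbours form a
  clique that dominates more than \<open>K\<close>. Otherwise \<open>w\<close> dominates everything far from \<open>K\<close>, and it
  extends to a dominating path.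
\<close>
lemma dominating_clique_or_P4:
  "(\<exists>K. clique K \<and> dom K = V) \<or> (\<exists>w v z d. E w v \<and> E v z \<and> E z d \<and> dom {w, v, z, d} = V)"
proof -
  let ?N = "\<lambda>K. card (dom K)"
  have dom_V: "dom X \<subseteq> V" for X
    by (auto simp: dom_def)
  obtain x0 where "x0 \<in> V"
    using nonempty_V by blast
  then have "clique {x0}"
    by (simp add: clique_def)
  moreover have bound: "\<forall>K. clique K \<longrightarrow> ?N K < Suc (card V)"
    using dom_V finite_V by (simp add: card_mono less_Suc_eq_le)
  ultimately obtain K where K: "clique K" and K_max: "\<And>K'. clique K' \<Longrightarrow> ?N K' \<le> ?N K"
    using ex_has_greatest_nat[of clique "{x0}" ?N] by blast
  \<comment> \<open>Maximality of \<open>K\<close> enters only in this form: a clique that dominates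
    some vertex outside \<open>dom K\<close> must miss some vertex of \<open>dom K\<close>.\<close>
  have not_larger: "\<not> dom K \<subset> dom K'" if "clique K'" for K'
    using K_max[OF that] psubset_card_mono[of "dom K'" "dom K"] dom_V finite_V finite_subset
    by (metis linorder_not_le)
  have K_ne: "K \<noteq> {}" and K_V: "K \<subseteq> V"
    using K by (auto simp: clique_def)
  note KE = cliqueD[OF K]
  show ?thesis
  proof (cases "dom K = V")
    case True
    with K show ?thesis by blast
  next
    case False
    \<comment> \<open>\<open>A w\<close> is the trace of \<open>w\<close> on \<open>K\<close>;
      \<open>N1\<close> and \<open>V2\<close> are the vertices at distance one from \<open>K\<close>
      and at distance at least two.\<close>
    define A where "A w = {k \<in> K. E k w}" for w
    define N1 where "N1 = dom K - K"
    define V2 where "V2 = V - dom K"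
    have A_ne: "A w \<noteq> {}" if "w \<in> N1" for w
      using that by (auto simp: A_def N1_def dom_def)
    have A_sub: "A w \<subseteq> K" for w
      by (auto simp: A_def)
    have A_iff: "k \<in> A w \<longleftrightarrow> E k w" "k \<in> A w \<longleftrightarrow> E w k" if "k \<in> K" for k w
      using that by (auto simp: A_def E_commute)
    have V2K: "\<not> E k v" "\<not> E v k" if "v \<in> V2" "k \<in> K" for v k
      using that by (auto simp: V2_def dom_def E_commute)
    have N1V: "w \<in> V" if "w \<in> N1" for w
      using that by (auto simp: N1_def dom_def)
    have V2V: "v \<in> V" if "v \<in> V2" for v
      using that by (simp add: V2_def)
    have V_split: "x \<in> K \<or> x \<in> N1 \<or> x \<in> V2" if "x \<in> V" for x
      using that by (auto simp: V2_def N1_def)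
    have K_dom: "k \<in> dom K" if "k \<in> K" for k
      using that K_V by (auto simp: dom_def)
    have A_ne_K: "A w \<noteq> K" if "w \<in> N1" "v \<in> V2" "E w v" for w v
    proof
      assume AK: "A w = K"
      have "clique (insert w K)"
        using K AK N1V[OF that(1)] A_iff(1)[of _ w] by (auto simp: clique_def E_commute)
      moreover have "dom K \<subseteq> dom (insert w K)"
        by (auto simp: dom_def)
      moreover have "v \<in> dom (insert w K)" "v \<notin> dom K"
        using that(2,3) V2V[OF that(2)] unfolding V2_def dom_def by blast+
      ultimately show False
        using not_larger by blast
    qed
    \<comment> \<open>No vertex is farther than distance two from \<open>K\<close>: otherwise the
      first such \<open>y\<close> extends to an induced path \<open>y\<close>, \<open>x\<close>,
      \<open>w\<close>, \<open>a\<close>, \<open>k\<close>, where \<open>w\<close> sees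
      \<open>a\<close> but not \<open>k\<close> in \<open>K\<close>.\<close>
    have reach: "\<exists>w\<in>N1. E w v" if "v \<in> V2" for v
    proof -
      let ?S = "dom K \<union> {v \<in> V2. \<exists>w\<in>N1. E w v}"
      have "?S = V"
      proof (rule closed_eq_V)
        show "?S \<subseteq> V" using dom_V V2V by blast
        show "?S \<noteq> {}" using K_ne K_dom by blast
        fix x y assume x: "x \<in> ?S" and xy: "E x y"
        show "y \<in> ?S"
        proof (rule ccontr)
          assume y: "y \<notin> ?S"
          then have y2: "y \<in> V2"
            using xy E_in_V by (auto simp: V2_def)
          have "x \<notin> N1" using xy y y2 by blast
          moreover have "x \<notin> K" using V2K(1)[OF y2] xy by blast
          ultimately obtain w where x2: "x \<in> V2" and w: "w \<in> N1" "E w x"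
            using x by (auto simp: N1_def)
          obtain a where a: "a \<in> A w" using A_ne[OF w(1)] by blast
          obtain k where k: "k \<in> K" "k \<notin> A w"
            using A_ne_K[OF w(1) x2 w(2)] A_sub by blast
          have aK: "a \<in> K" using a A_sub by blast
          have "E y x" "E x w" "E w a" "E a k"
            using xy w a k aK A_iff KE by (auto simp: E_commute)
          from no_P5[OF this] show False
            using V2K y2 x2 aK k w(1) y A_iff(2)[of k w] by (auto simp: E_commute)
        qed
      qed
      with that show ?thesis by (auto simp: V2_def)
    qed
    \<comment> \<open>In the path \<open>v'\<close>, \<open>v\<close>, \<open>w\<close>,
      \<open>a\<close>, \<open>k\<close> the only possible chord joins \<open>v'\<close> to
      \<open>w\<close>. Hence the neighbours of \<open>w\<close> in \<open>V2\<close> form a union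
      of components of \<open>V2\<close>.\<close>
    have homogeneous: "E w v'" if "w \<in> N1" "v \<in> V2" "v' \<in> V2" "E w v" "E v v'" for w v v'
    proof -
      note wv = that
      obtain a where a: "a \<in> A w" using A_ne[OF wv(1)] by blast
      obtain k where k: "k \<in> K" "k \<notin> A w"
        using A_ne_K[OF wv(1,2,4)] A_sub by blast
      have aK: "a \<in> K" using a A_sub by blast
      have "E v' v" "E v w" "E w a" "E a k"
        using wv a k aK A_iff KE by (auto simp: E_commute)
      from no_P5[OF this] show ?thesis
        using V2K wv(2,3) aK k A_iff(2)[of k w] by (auto simp: E_commute)
    qed
    \<comment> \<open>The path \<open>z\<close>, \<open>d\<close>, \<open>a\<close>,
      \<open>w\<close>, \<open>v\<close> runs through \<open>K\<close> between the disjoint traces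
      of \<open>z\<close> and \<open>w\<close>; its only possible chord is \<open>z\<close> to
      \<open>v\<close>.\<close>
    have opposite_adj: "E z v"
      if "w \<in> N1" "z \<in> N1" "v \<in> V2" "E w v" "\<not> E z w" "A z \<inter> A w = {}" for w z v
    proof -
      note wv = that
      obtain a where a: "a \<in> A w" using A_ne[OF wv(1)] by blast
      obtain d where d: "d \<in> A z" using A_ne[OF wv(2)] by blast
      have K: "a \<in> K" "d \<in> K" and ne: "a \<noteq> d" "d \<notin> A w" "a \<notin> A z"
        using a d A_sub wv(6) by blast+
      have "E z d" "E d a" "E a w" "E w v"
        using a d K ne A_iff KE wv(4) by auto
      from no_P5[OF this] show ?thesis
        using V2K wv(3,5) K ne A_iff by (auto simp: E_commute)
    qed
    \<comment> \<open>The clique formed by \<open>w\<close> and its trace dominates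
      \<open>v\<close>, so it misses some \<open>z\<close> in \<open>dom K\<close>. As it meets
      \<open>K\<close>, it dominates all of \<open>K\<close>, which puts \<open>z\<close> in
      \<open>N1\<close>.\<close>
    have opposite: "\<exists>z\<in>N1. \<not> E z w \<and> A z \<inter> A w = {}" if "w \<in> N1" "v \<in> V2" "E w v" for w v
    proof -
      note wv = that
      let ?K = "insert w (A w)"
      have "clique ?K"
        using K N1V[OF wv(1)] by (auto simp: clique_def A_def E_commute)
      moreover have "v \<in> dom ?K" "v \<notin> dom K"
        using wv(2,3) V2V[OF wv(2)] unfolding V2_def dom_def by blast+
      ultimately obtain z where z: "z \<in> dom K" "z \<notin> dom ?K"
        using not_larger by blast
      have zV: "z \<in> V" using z(1) dom_V by blast
      obtain a where a: "a \<in> A w" "a \<in> K" using A_ne[OF wv(1)] A_sub by blast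
      have "z \<notin> K"
        using z(2) zV a KE[of a z] by (auto simp: dom_def)
      with z(1) have "z \<in> N1" by (simp add: N1_def)
      moreover have "\<not> E z w" "A z \<inter> A w = {}"
        using z(2) zV by (auto simp: dom_def A_def E_commute)
      ultimately show ?thesis by blast
    qed
    define F where "F w = {v \<in> V2. E w v}" for w
    have fin_F: "finite (F w)" for w
      using finite_V by (auto simp: F_def V2_def)
    obtain v0 where v0: "v0 \<in> V2"
      using False dom_V by (auto simp: V2_def)
    then obtain w0 where w0: "w0 \<in> N1" "E w0 v0" using reach by blast
    have "\<forall>w. w \<in> N1 \<longrightarrow> card (F w) < Suc (card V)"
      using finite_V V2V by (simp add: F_def less_Suc_eq_le card_mono subset_iff)
    then obtain w where w: "w \<in> N1" and w_max: "\<And>q. q \<in> N1 \<Longrightarrow> card (F q) \<le> card (F w)"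
      using ex_has_greatest_nat[of "\<lambda>w. w \<in> N1" w0 "\<lambda>w. card (F w)"] w0(1) by blast
    have "F w0 \<noteq> {}" using v0 w0 by (auto simp: F_def)
    then have "card (F w) > 0"
      using w_max[OF w0(1)] fin_F[of w0] by (metis card_gt_0_iff le_less_trans not_le)
    then obtain v where v: "v \<in> V2" "E w v"
      by (auto simp: F_def card_gt_0_iff)
    have V2w: "E w y" if y: "y \<in> V2" for y
    proof (rule ccontr)
      assume wy: "\<not> E w y"
      have nbr: "E q w \<and> (A q = A w \<or> A q \<union> A w = K)" if q: "q \<in> N1" "E q y" for q
      proof -
        have "y \<in> F q - F w" using q y wy by (simp add: F_def)
        then have "\<not> F w \<subseteq> F q"
          using w_max[OF q(1)] fin_F card_subset_eq[of "F q" "F w"] card_mono[of "F q" "F w"]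
          by (metis Diff_iff antisym)
        \<comment> \<open>\<open>q\<close> sees \<open>y\<close> and \<open>w\<close> does not, so
          by the choice of \<open>w\<close> some \<open>x\<close> in \<open>V2\<close> is seen by
          \<open>w\<close> and not by \<open>q\<close>.\<close>
        then obtain x where x: "x \<in> V2" "E w x" "\<not> E q x" by (auto simp: F_def)
        have xy: "\<not> E x y" using homogeneous[OF w x(1) y x(2)] wy by blast
        have qw: "E q w"
        proof (rule ccontr)
          assume nqw: "\<not> E q w"
          show False
          proof (cases "A q \<inter> A w = {}")
            case True
            then have "E q x" using opposite_adj[OF w q(1) x(1,2) nqw] by blast
            with x show False by blast
          next
            case False
            then obtain e where e: "e \<in> A q" "e \<in> A w" "e \<in> K" using A_sub by blast
            have "E y q" "E q e" "E e w" "E w x"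
              using e q x A_iff by (auto simp: E_commute)
            from no_P5[OF this] show False
              using V2K[OF y e(3)] V2K[OF x(1) e(3)] nqw wy xy x(3) by (auto simp: E_commute)
          qed
        qed
        \<comment> \<open>If the traces differ in \<open>e\<close> while \<open>k\<close> lies in
          neither, one of the paths \<open>x\<close>, \<open>w\<close>, \<open>q\<close>,
          \<open>e\<close>, \<open>k\<close> and \<open>y\<close>, \<open>q\<close>,
          \<open>w\<close>, \<open>e\<close>, \<open>k\<close> is an induced P5, depending on which
          trace contains \<open>e\<close>.\<close>
        have "A q \<union> A w = K" if "e \<in> A q - A w" for e
        proof (rule ccontr)
          assume "A q \<union> A w \<noteq> K"
          then obtain k where k: "k \<in> K" "k \<notin> A q" "k \<notin> A w" using A_sub by blast
          have e: "e \<in> A q" "e \<notin> A w" "e \<in> K" "e \<noteq> k" using that A_sub k by blast+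
          have "E x w" "E w q" "E q e" "E e k"
            using e k x qw A_iff KE by (auto simp: E_commute)
          from no_P5[OF this] show False
            using V2K[OF x(1) e(3)] V2K[OF x(1) k(1)] x(3) e k A_iff by (auto simp: E_commute)
        qed
        moreover have "A q \<union> A w = K" if "e \<in> A w - A q" for e
        proof (rule ccontr)
          assume "A q \<union> A w \<noteq> K"
          then obtain k where k: "k \<in> K" "k \<notin> A q" "k \<notin> A w" using A_sub by blast
          have e: "e \<in> A w" "e \<notin> A q" "e \<in> K" "e \<noteq> k" using that A_sub k by blast+
          have "E y q" "E q w" "E w e" "E e k"
            using e k q qw A_iff KE by (auto simp: E_commute)
          from no_P5[OF this] show False
            using V2K[OF y e(3)] V2K[OF y k(1)] wy e k A_iff by (auto simp: E_commute)
        qed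
        ultimately show ?thesis using qw by blast
      qed
      obtain q0 where q0: "q0 \<in> N1" "E q0 y" using reach[OF y] by blast
      obtain q1 where q1: "q1 \<in> N1" "\<not> E q1 q0" "A q1 \<inter> A q0 = {}"
        using opposite[OF q0(1) y q0(2)] by blast
      have q1y: "E q1 y" using opposite_adj[OF q0(1) q1(1) y q0(2) q1(2,3)] .
      have "A w \<noteq> K" using A_ne_K[OF w v] .
      \<comment> \<open>If neither trace equalled \<open>A w\<close>, both would contain the
        nonempty set \<open>K - A w\<close>, although they are disjoint.\<close>
      then have "A q0 = A w \<or> A q1 = A w"
        using nbr[OF q0] nbr[OF q1(1) q1y] q1(3) A_sub[of w] by blast
      then obtain q where q: "q \<in> N1" "E q y" "A q = A w"
        using q0 q1(1) q1y by blast
      have qw: "E q w" using nbr q by blast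
      \<comment> \<open>This clique dominates \<open>y\<close>, so it misses some \<open>u\<close>
        in \<open>N1\<close>. Then \<open>u\<close> is adjacent to \<open>y\<close> by
        \<open>opposite_adj\<close>, and \<open>nbr\<close> makes it adjacent to \<open>w\<close>
        after all.\<close>
      let ?K = "{w, q} \<union> A w"
      have "clique ?K"
        using K N1V[OF w] N1V[OF q(1)] qw q(3) by (auto simp: clique_def A_def E_commute)
      moreover have "y \<in> dom ?K" "y \<notin> dom K"
        using y q(2) V2V[OF y] unfolding V2_def dom_def by blast+
      ultimately obtain u where u: "u \<in> dom K" "u \<notin> dom ?K"
        using not_larger by blast
      have uV: "u \<in> V" using u(1) dom_V by blast
      obtain a where a: "a \<in> A w" "a \<in> K" using A_ne[OF w] A_sub by blast
      have "u \<notin> K"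
        using u(2) uV a KE[of a u] by (auto simp: dom_def)
      with u(1) have u1: "u \<in> N1" by (simp add: N1_def)
      have un: "\<not> E u w" "\<not> E u q" "A u \<inter> A q = {}"
        using u(2) uV q(3) by (auto simp: dom_def A_def E_commute)
      have "E u y" using opposite_adj[OF q(1) u1 y q(2) un(2,3)] .
      with nbr[OF u1] un(1) show False by blast
    qed
    obtain z where z: "z \<in> N1" "\<not> E z w" "A z \<inter> A w = {}"
      using opposite[OF w v] by blast
    have zv: "E z v" using opposite_adj[OF w z(1) v z(2,3)] .
    obtain d where d: "d \<in> A z" "d \<in> K" using A_ne[OF z(1)] A_sub by blast
    have zd: "E z d" using d A_iff by blast
    \<comment> \<open>\<open>w\<close> dominates \<open>V2\<close> and \<open>d\<close> dominates
      \<open>K\<close>, so an undominated \<open>x\<close> lies in \<open>N1\<close>. Its trace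
      meets that of \<open>w\<close>, since otherwise \<open>x\<close> would see \<open>v\<close>; a
      common vertex \<open>a\<close> gives the induced path \<open>x\<close>, \<open>a\<close>,
      \<open>d\<close>, \<open>z\<close>, \<open>v\<close>.\<close>
    have "x \<in> dom {w, v, z, d}" if xV: "x \<in> V" for x
    proof (rule ccontr)
      assume "x \<notin> dom {w, v, z, d}"
      then have x: "x \<noteq> d" "\<not> E w x" "\<not> E v x" "\<not> E z x" "\<not> E d x"
        using xV by (auto simp: dom_def)
      have "x \<notin> V2" using V2w x by blast
      moreover have "x \<notin> K" using x d KE by blast
      ultimately have x1: "x \<in> N1" using V_split xV by blast
      have "A x \<inter> A w \<noteq> {}"
        using opposite_adj[OF w x1 v] x by (auto simp: E_commute)
      then obtain a where a: "a \<in> A x" "a \<in> A w" "a \<in> K" using A_sub by blast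
      have az: "a \<notin> A z" "a \<noteq> d" using a z(3) d by blast+
      have "E x a" "E a d" "E d z" "E z v"
        using a az d zd zv A_iff KE by (auto simp: E_commute)
      from no_P5[OF this] show False
        using x az a V2K[OF v(1) a(3)] V2K[OF v(1) d(2)] A_iff by (auto simp: E_commute)
    qed
    then have "dom {w, v, z, d} = V" using dom_V by blast
    then show ?thesis using v(2) zv zd sym by blast
  qed
qed

section \<open>Colouring from a smallest dominating clique\<close>

lemma dominatedE:
  assumes "dom X = V" "v \<in> V" "v \<notin> X"
  obtains x where "x \<in> X" "E x v" "E v x"
proof -
  have "v \<in> dom X" using assms(1,2) by simp
  then show ?thesis using assms(3) that sym by (auto simp: dom_def)
qed

text \<open>Among \<open>t\<close> such vertices, some \<open>i\<close> and \<open>j\<close> would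
  have adjacent private neighbours. With \<open>a\<close> a neighbour of \<open>u\<close> in
  \<open>K\<close>, the path \<open>p i\<close>, \<open>p j\<close>, \<open>j\<close>,
  \<open>a\<close>, \<open>u\<close> would then be an induced P5.\<close>

lemma card_common_nonneighbours_far_pair:
  assumes K: "clique K" "dom K = V"
    and priv: "\<And>k x. k \<in> K \<Longrightarrow> x \<in> K \<Longrightarrow> E x (p k) \<longleftrightarrow> x = k"
    and not_indep: "\<And>I. I \<subseteq> K \<Longrightarrow> card I = t \<Longrightarrow> \<exists>i\<in>I. \<exists>j\<in>I. E (p i) (p j)"
    and uv: "u \<in> V" "v \<in> V" "u \<notin> K" "v \<notin> K" "\<not> E u v" "\<And>m. E u m \<Longrightarrow> \<not> E m v"
  shows "card {k \<in> K. \<not> E u k \<and> \<not> E v k} < t"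
proof (rule ccontr)
  assume "\<not> ?thesis"
  then obtain I where I: "I \<subseteq> {k \<in> K. \<not> E u k \<and> \<not> E v k}" "card I = t"
    using obtain_subset_with_card_n[of t "{k \<in> K. \<not> E u k \<and> \<not> E v k}"] by auto
  then obtain i j where ij: "i \<in> I" "j \<in> I" "E (p i) (p j)"
    using not_indep[of I] by blast
  obtain a where a: "a \<in> K" "E u a"
    using dominatedE[OF K(2) uv(1,3)] by blast
  obtain b where b: "b \<in> K" "E v b"
    using dominatedE[OF K(2) uv(2,4)] by blast
  have aeb: "\<not> E v a" "\<not> E u b" "a \<noteq> b"
    using uv(6) a b sym by blast+
  have I_iff: "i \<in> K \<and> \<not> E u i \<and> \<not> E v i" if "i \<in> I" for i
    using I that by blast
  \<comment> \<open>An edge from \<open>u\<close> to \<open>p k\<close> would make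
    \<open>p k\<close>, \<open>u\<close>, \<open>a\<close>, \<open>b\<close>, \<open>v\<close> an
    induced P5, because \<open>u\<close> and \<open>v\<close> have no common neighbour.\<close>
  have far: "\<not> E u (p k)" if "k \<in> I" for k
  proof
    assume up: "E u (p k)"
    have k: "k \<in> K" "k \<noteq> a" "k \<noteq> b"
      using I_iff[OF that] a b by auto
    have "E (p k) u" "E u a" "E a b" "E b v"
      using up a b aeb cliqueD[OF K(1)] by (auto simp: E_commute)
    from no_P5[OF this] show False
      using uv(5) uv(6)[OF up] aeb k priv[OF k(1) a(1)] priv[OF k(1) b(1)]
      by (auto simp: E_commute)
  qed
  have k: "i \<in> K" "j \<in> K" "i \<noteq> a" "j \<noteq> a" "i \<noteq> j" "\<not> E u i" "\<not> E u j"
    using I_iff[OF ij(1)] I_iff[OF ij(2)] a ij irrefl by auto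
  have "E (p i) (p j)" "E (p j) j" "E j a" "E a u"
    using ij k a priv cliqueD[OF K(1)] by (auto simp: E_commute)
  from no_P5[OF this] show False
    using far[OF ij(1)] far[OF ij(2)] k priv[OF k(1,2)] priv[OF k(1) a(1)]
      priv[OF k(2) a(1)] by (auto simp: E_commute)
qed

text \<open>Paths with at most one internal vertex are rainbow under any colouring, so only pairs at
  distance at least three constrain \<open>c\<close>. The hypothesis \<open>no_pendant\<close>
  expresses that a clique of size \<open>t\<close> has no independent system of private
  neighbours.\<close>

lemma dominating_clique_colouring:
  fixes t :: nat
  assumes K0: "clique K0" "dom K0 = V" and t: "t > 0"
    and no_pendant: "\<And>I p. \<lbrakk>clique I; card I = t; \<And>i j. i \<in> I \<Longrightarrow> j \<in> I \<Longrightarrow> E i (p j) \<longleftrightarrow> i = j\<rbrakk>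
      \<Longrightarrow> \<exists>i\<in>I. \<exists>j\<in>I. E (p i) (p j)"
  shows "\<exists>c :: 'a \<Rightarrow> nat. c ` V \<subseteq> {..t} \<and> (\<forall>u\<in>V. \<forall>v\<in>V. u \<noteq> v \<longrightarrow> E u v \<or>
    (\<exists>m. E u m \<and> E m v) \<or> (\<exists>r s. E u r \<and> E r s \<and> E s v \<and> c r \<noteq> c s))"
proof -
  obtain K where K: "clique K" "dom K = V"
    and K_min: "\<And>K'. clique K' \<Longrightarrow> dom K' = V \<Longrightarrow> card K \<le> card K'"
    using ex_has_least_nat[of "\<lambda>K. clique K \<and> dom K = V" K0 card] K0 by blast
  have fin: "finite K" and K_V: "K \<subseteq> V"
    using K(1) finite_V by (auto simp: clique_def intro: finite_subset)
  obtain T where T: "T \<subseteq> K" "card T = min t (card K)"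
    using obtain_subset_with_card_n[of "min t (card K)" K] by auto
  have "finite T" using T(1) fin finite_subset by blast
  then obtain h where h: "bij_betw h T {0..<card T}"
    using ex_bij_betw_finite_nat by blast
  \<comment> \<open>The vertices of \<open>T\<close> get distinct colours below \<open>t\<close>;
    colour \<open>t\<close> is shared by all others. So a vertex of \<open>T\<close> shares its
    colour with no other vertex.\<close>
  define c where "c x = (if x \<in> T then h x else t)" for x
  have hT: "h x < t" if "x \<in> T" for x
    using bij_betwE[OF h] that T(2) by fastforce
  have inj: "x = y" if "x \<in> T" "c x = c y" for x y
    using that hT h unfolding c_def bij_betw_def inj_on_def by (metis less_irrefl)
  have far: "\<exists>r s. E u r \<and> E r s \<and> E s v \<and> c r \<noteq> c s"
    if uv: "u \<in> V" "v \<in> V" "u \<noteq> v" "\<not> E u v" "\<And>m. E u m \<Longrightarrow> \<not> E m v" for u v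
  proof -
    have uK: "u \<notin> K"
    proof
      assume "u \<in> K"
      have "v \<notin> K" using cliqueD[OF K(1) \<open>u \<in> K\<close>] uv by blast
      then obtain k where "k \<in> K" "E k v" using dominatedE[OF K(2) uv(2)] by blast
      then show False using cliqueD[OF K(1) \<open>u \<in> K\<close>] uv by metis
    qed
    have vK: "v \<notin> K"
    proof
      assume "v \<in> K"
      obtain k where "k \<in> K" "E k u" using dominatedE[OF K(2) uv(1) uK] by blast
      then show False using cliqueD[OF K(1) _ \<open>v \<in> K\<close>] uv sym by metis
    qed
    obtain a where a: "a \<in> K" "E u a"
      using dominatedE[OF K(2) uv(1) uK] by blast
    obtain b where b: "b \<in> K" "E b v"
      using dominatedE[OF K(2) uv(2) vK] by blast
    have disj: "x \<noteq> y" if "E u x" "E y v" for x y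
      using that uv(5) by blast
    define S where "S = {k \<in> K. E u k \<or> E k v}"
    have "\<exists>x\<in>S. \<exists>y\<in>S. c x \<noteq> c y"
    proof (cases "card K \<le> t")
      case True
      then have "T = K" using T fin card_subset_eq by (metis min.absorb2)
      then have "c a \<noteq> c b" using inj a b disj by blast
      then show ?thesis using a b by (auto simp: S_def)
    next
      case False
      \<comment> \<open>By minimality \<open>K - {k}\<close> is not dominating; a vertex it misses
        lies outside \<open>K\<close> and is seen from \<open>K\<close> by \<open>k\<close>
        alone.\<close>
      have "\<exists>p. \<forall>x\<in>K. E x p \<longleftrightarrow> x = k" if k: "k \<in> K" for k
      proof -
        have "\<not> K \<subseteq> {k}"
          using False t card_mono[of "{k}" K] by force
        then obtain k' where k': "k' \<in> K" "k' \<noteq> k" by blast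
        have "clique (K - {k})"
          using K(1) k' by (auto simp: clique_def)
        moreover have "card (K - {k}) < card K"
          using fin k by (rule card_Diff1_less)
        ultimately have "dom (K - {k}) \<noteq> V"
          using K_min by fastforce
        then obtain p where p: "p \<in> V" "p \<notin> K - {k}" "\<And>x. x \<in> K - {k} \<Longrightarrow> \<not> E x p"
          by (auto simp: dom_def)
        have "p \<notin> K"
          using p(2) p(3)[of k'] k' cliqueD[OF K(1) k'(1) k] by auto
        then have "\<exists>x\<in>K. E x p"
          using dominatedE[OF K(2) p(1)] by blast
        then show ?thesis using p(3) by blast
      qed
      then obtain p where p: "\<And>k x. k \<in> K \<Longrightarrow> x \<in> K \<Longrightarrow> E x (p k) \<longleftrightarrow> x = k"
        by metis
      have S_compl: "K - S = {k \<in> K. \<not> E u k \<and> \<not> E v k}"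
        by (auto simp: S_def E_commute)
      have "card (K - S) < t"
        unfolding S_compl
      proof (rule card_common_nonneighbours_far_pair[OF K, of p])
        fix I assume I: "I \<subseteq> K" "card I = t"
        then have "clique I"
          using K(1) t by (auto simp: clique_def)
        then show "\<exists>i\<in>I. \<exists>j\<in>I. E (p i) (p j)"
          by (rule no_pendant) (use I p in auto)
      qed (use p uv uK vK in auto)
      moreover have "card (K - S) = card K - card S"
        by (rule card_Diff_subset) (auto simp: S_def intro: finite_subset[OF _ fin])
      \<comment> \<open>Thus \<open>S\<close> has more elements than \<open>K - T\<close> and must
        meet \<open>T\<close>. A vertex \<open>x\<close> in both has its own colour, so a
        monochromatic \<open>S\<close> would force \<open>a = x = b\<close>.\<close>
      ultimately have card_S: "card K < t + card S" using False by linarith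
      show ?thesis
      proof (rule ccontr)
        assume mono: "\<not> ?thesis"
        show False
        proof (cases "S \<inter> T = {}")
          case True
          then have "S \<subseteq> K - T" by (auto simp: S_def)
          then have "card S \<le> card (K - T)" using fin by (simp add: card_mono)
          also have "\<dots> = card K - t"
            using T False \<open>finite T\<close> by (simp add: card_Diff_subset)
          finally show False using card_S False by linarith
        next
          case False
          then obtain x where x: "x \<in> S" "x \<in> T" by blast
          then have "a = x" "b = x"
            using mono inj a b by (auto simp: S_def)
          then show False using disj a b by blast
        qed
      qed
    qed
    then obtain x y where xy: "x \<in> S" "y \<in> S" "c x \<noteq> c y" by blast
    \<comment> \<open>If \<open>x\<close> and \<open>y\<close> are both neighbours of
      \<open>u\<close>, then \<open>b\<close> differs in colour from one of them; \<open>a\<close>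
      serves likewise when both are neighbours of \<open>v\<close>.\<close>
    have "\<exists>r\<in>K. \<exists>s\<in>K. E u r \<and> E s v \<and> c r \<noteq> c s"
      using xy a b unfolding S_def mem_Collect_eq by metis
    then show ?thesis using cliqueD[OF K(1)] disj by blast
  qed
  show ?thesis
  proof (intro exI[of _ c] conjI ballI impI)
    show "c ` V \<subseteq> {..t}"
      using hT by (auto simp: c_def less_imp_le)
    fix u v assume "u \<in> V" "v \<in> V" "u \<noteq> v"
    then show "E u v \<or> (\<exists>m. E u m \<and> E m v) \<or> (\<exists>r s. E u r \<and> E r s \<and> E s v \<and> c r \<noteq> c s)"
      using far[of u v] by metis
  qed
qed

end

section \<open>Transfer to the digraph library\<close>

text \<open>The subgraph induced on the image of \<open>f\<close> is isomorphic to \<open>X\<close>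
  via the inverse of \<open>f\<close>. Each arc is sent to the pair of its ends, which is injective
  because \<open>G\<close> has no parallel arcs.\<close>

lemma not_free_of_embedding:
  assumes "graph G" "pair_graph X"
    and inj: "inj_on f (pverts X)" and f_verts: "f ` pverts X \<subseteq> verts G"
    and arcs_iff: "\<And>x y. x \<in> pverts X \<Longrightarrow> y \<in> pverts X \<Longrightarrow>
      (f x, f y) \<in> arcs_ends G \<longleftrightarrow> (x, y) \<in> parcs X"
  shows "\<not> free_of X G"
proof -
  interpret G: graph G by fact
  interpret X: pair_graph X by fact
  let ?H = "G \<restriction> (f ` pverts X)"
  define g where "g = the_inv_into (pverts X) f"
  have g: "g (f x) = x" if "x \<in> pverts X" for x
    using inj that by (simp add: g_def the_inv_into_f_f)
  define hom where "hom = \<lparr>iso_verts = g,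
    iso_arcs = \<lambda>e. (g (tail G e), g (head G e)), iso_head = snd, iso_tail = fst\<rparr>"
  have ind: "induced_subgraph ?H G"
    using G.induced_induce f_verts by blast
  have wf: "wf_digraph ?H"
    by (rule G.wellformed_induce_subgraph)
  have "inj_on g (f ` pverts X)"
    by (auto simp: inj_on_def g)
  moreover have "inj_on (iso_arcs hom) (arcs ?H)"
  proof (rule inj_onI)
    fix e e' assume e: "e \<in> arcs ?H" "e' \<in> arcs ?H" "iso_arcs hom e = iso_arcs hom e'"
    then have "tail G e = tail G e'" "head G e = head G e'"
      by (auto simp: hom_def g)
    with e show "e = e'"
      using G.no_multi_arcs[of e e'] by (auto simp: arc_to_ends_def)
  qed
  ultimately have "pre_digraph.digraph_isomorphism ?H hom"
    using wf by (auto simp: pre_digraph.digraph_isomorphism_def hom_def)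
  moreover have "with_proj X = app_iso hom ?H"
  proof -
    have "pverts X = g ` f ` pverts X"
      by (auto simp: image_image g)
    moreover have "parcs X = iso_arcs hom ` arcs ?H"
    proof (intro equalityI subsetI)
      fix a assume a: "a \<in> parcs X"
      obtain x y where xy: "a = (x, y)" by (cases a)
      then have V: "x \<in> pverts X" "y \<in> pverts X"
        using a X.in_arcsD1 X.in_arcsD2 by auto
      then have "(f x, f y) \<in> arcs_ends G" using arcs_iff a xy by blast
      then obtain e where "e \<in> arcs G" "tail G e = f x" "head G e = f y"
        by (auto simp: arcs_ends_def arc_to_ends_def)
      then have "e \<in> arcs ?H" "iso_arcs hom e = a"
        using V xy by (auto simp: hom_def g)
      then show "a \<in> iso_arcs hom ` arcs ?H" by blast
    next
      fix a assume "a \<in> iso_arcs hom ` arcs ?H"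
      then obtain e x y where e: "e \<in> arcs G" "tail G e = f x" "head G e = f y"
        "x \<in> pverts X" "y \<in> pverts X" "a = (x, y)"
        by (auto simp: hom_def g)
      then have "(f x, f y) \<in> arcs_ends G"
        by (force simp: arcs_ends_def arc_to_ends_def)
      with e show "a \<in> parcs X" using arcs_iff by blast
    qed
    ultimately show ?thesis
      by (simp add: with_proj_def app_iso_def hom_def)
  qed
  ultimately have "digraph_iso ?H X"
    unfolding digraph_iso_def by blast
  with ind show ?thesis
    unfolding free_of_def by blast
qed

text \<open>A path from \<open>u\<close> to \<open>v\<close> inside \<open>X\<close> together with
  \<open>u\<close> and \<open>v\<close> repeats no vertex, so its internal vertices all lie in
  \<open>X\<close>, where \<open>c\<close> is injective.\<close>

lemma rainbow_connected_dominating_set: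
  assumes "graph G" and X: "X \<subseteq> verts G" and inj: "inj_on c X"
    and conn: "\<And>x y. x \<in> X \<Longrightarrow> y \<in> X \<Longrightarrow> x \<rightarrow>\<^sup>*\<^bsub>G \<restriction> X\<^esub> y"
    and dom: "\<And>v. v \<in> verts G \<Longrightarrow> v \<in> X \<or> (\<exists>x\<in>X. (x, v) \<in> arcs_ends G)"
  shows "rainbow_vertex_connected G c"
  unfolding rainbow_vertex_connected_def
proof (intro ballI impI)
  interpret G: graph G by fact
  fix u v assume uv: "u \<in> verts G" "v \<in> verts G" "u \<noteq> v"
  let ?S = "insert u (insert v X)"
  have S: "?S \<subseteq> verts G" using X uv by blast
  interpret H: wf_digraph "G \<restriction> ?S" by (rule G.wellformed_induce_subgraph)
  have edge: "x \<rightarrow>\<^sup>*\<^bsub>G \<restriction> ?S\<^esub> y \<and> y \<rightarrow>\<^sup>*\<^bsub>G \<restriction> ?S\<^esub> x" if "x \<in> ?S" "y \<in> ?S" "(x, y) \<in> arcs_ends G" for x y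
  proof -
    have "(y, x) \<in> arcs_ends G" using that(3) G.sym_arcs by (auto simp: symmetric_def sym_def)
    then have "x \<rightarrow>\<^bsub>G \<restriction> ?S\<^esub> y" "y \<rightarrow>\<^bsub>G \<restriction> ?S\<^esub> x"
      using that by (auto simp: arcs_ends_def arc_to_ends_def)
    then show ?thesis by blast
  qed
  have to_X: "\<exists>x\<in>X. x \<rightarrow>\<^sup>*\<^bsub>G \<restriction> ?S\<^esub> y \<and> y \<rightarrow>\<^sup>*\<^bsub>G \<restriction> ?S\<^esub> x" if y: "y \<in> {u, v}" for y
  proof (cases "y \<in> X")
    case True
    moreover from True have "y \<rightarrow>\<^sup>*\<^bsub>G \<restriction> ?S\<^esub> y" by (intro H.reachable_refl) simp
    ultimately show ?thesis by blast
  next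
    case False
    then obtain x where "x \<in> X" "(x, y) \<in> arcs_ends G" using dom y uv by blast
    then show ?thesis using edge[of x y] y by blast
  qed
  have XS: "x \<rightarrow>\<^sup>*\<^bsub>G \<restriction> ?S\<^esub> y" if "x \<in> X" "y \<in> X" for x y
    by (rule G.reachable_induce_ss[OF conn[OF that]]) blast
  have "u \<rightarrow>\<^sup>*\<^bsub>G \<restriction> ?S\<^esub> v"
  proof -
    obtain x where x: "x \<in> X" "u \<rightarrow>\<^sup>*\<^bsub>G \<restriction> ?S\<^esub> x" using to_X[of u] by blast
    obtain y where y: "y \<in> X" "y \<rightarrow>\<^sup>*\<^bsub>G \<restriction> ?S\<^esub> v" using to_X[of v] by blast
    show ?thesis
      by (rule H.reachable_trans[OF x(2) H.reachable_trans[OF XS[OF x(1) y(1)] y(2)]])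
  qed
  then obtain p where p: "vpath p (G \<restriction> ?S)" "hd p = u" "last p = v"
    unfolding H.reachable_vpath_conv by blast
  have pG: "vpath p G" and pS: "set p \<subseteq> ?S" and dist: "distinct p"
    using p(1) S by (auto simp: vpath_def vwalk_def arcs_ends_def arc_to_ends_def)
  have p_ne: "p \<noteq> []" using p(1) by (auto simp: vpath_def vwalk_def)
  have "u \<notin> set (tl p)"
    using p(2) p_ne dist by (cases p) auto
  moreover have "v \<notin> set (butlast p)"
    using p(3) p_ne dist by (metis append_butlast_last_id distinct_butlast not_distinct_conv_prefix)
  ultimately have "set (butlast (tl p)) \<subseteq> X"
    using pS in_set_butlastD[of _ "tl p"] list.set_sel(2)[OF p_ne] butlast_tl[of p]
      list.set_sel(2)[of "butlast p"] by (smt (verit) insertE list.sel(2) subset_iff)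
  then have "inj_on c (set (butlast (tl p)))"
    using inj inj_on_subset by blast
  then have "vertex_rainbow c p"
    unfolding vertex_rainbow_def distinct_map using dist by (simp add: distinct_butlast distinct_tl)
  with pG p show "\<exists>p. joins G u p v \<and> vertex_rainbow c p"
    unfolding joins_def by blast
qed

section \<open>The bound for rvc from the two kinds of dominating set\<close>

theorem theorem7:
  fixes G :: "('a, 'b) pre_digraph" and t :: nat
  assumes "t \<ge> 4"
    and "graph G"
    and "connected G"
    and "free_of (path_graph 5) G"
    and "free_of (complete_pendant_graph t) G"
  shows "rvc G \<le> diam G + t"
proof (cases "K\<^bsub>card (verts G)\<^esub> G")
  case True
  then show ?thesis by (simp add: rvc_def)
next
  case False
  interpret G: graph G by fact
  define E where "E x y \<longleftrightarrow> (x, y) \<in> arcs_ends G" for x y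
  have E_sym: "E x y \<Longrightarrow> E y x" for x y
    using G.sym_arcs by (auto simp: E_def symmetric_def sym_def)
  have E_irrefl: "\<not> E x x" for x
    using G.no_loops by (auto simp: E_def arcs_ends_def arc_to_ends_def)
  have E_verts: "E x y \<Longrightarrow> x \<in> verts G \<and> y \<in> verts G" for x y
    by (auto simp: E_def arcs_ends_def arc_to_ends_def)
  obtain u0 v0 where uv0: "u0 \<in> verts G" "v0 \<in> verts G" "u0 \<noteq> v0"
    using False \<open>graph G\<close> E_verts E_irrefl unfolding complete_digraph_def E_def by blast
  \<comment> \<open>Both colourings below use at most \<open>t + 1\<close> colours, so a positive
    diameter is enough.\<close>
  have "diam G > 0"
  proof -
    obtain p where p: "joins G u0 p v0" "vwalk_length p = graph_dist G u0 v0"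
      using graph_dist_attained[OF assms(2,3) uv0(1,2)] by blast
    have "vwalk_length p \<noteq> 0"
    proof
      assume "vwalk_length p = 0"
      then have "hd p = last p" using p(1) by (cases p) (auto simp: vwalk_length_def joins_def vpath_def vwalk_def)
      with p(1) uv0(3) show False unfolding joins_def by metis
    qed
    with p(2) show ?thesis
      using diam_attained(2)[OF assms(2,3) uv0(1,2)] by linarith
  qed
  interpret connected_P5_free "verts G" E
  proof
    fix S assume S: "S \<subseteq> verts G" "S \<noteq> {}" "\<And>x y. x \<in> S \<Longrightarrow> E x y \<Longrightarrow> y \<in> S"
    obtain x where x: "x \<in> S" using S(2) by blast
    have "y \<in> S" if "y \<in> verts G" for y
    proof -
      have "x \<in> verts G" using x S(1) by blast
      then have "\<exists>p. joins G x p y"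
        using connected_joins[OF assms(2,3) _ that] by metis
      then have "x \<rightarrow>\<^sup>*\<^bsub>G\<^esub> y"
        unfolding G.reachable_vpath_conv joins_def by blast
      then show "y \<in> S"
      proof (induction rule: G.reachable_induct)
        case base
        show ?case using x .
      next
        case (step a b)
        then show ?case using S(3)[of a b] by (simp add: E_def)
      qed
    qed
    with S(1) show "S = verts G" by blast
  next
    fix a b c d e assume edges: "E a b" "E b c" "E c d" "E d e"
    show "E a c \<or> E a d \<or> E a e \<or> E b d \<or> E b e \<or> E c e"
    proof (rule ccontr)
      assume non: "\<not> ?thesis"
      let ?f = "\<lambda>i :: nat. [a, b, c, d, e] ! i"
      have five: "pverts (path_graph 5) = {0, 1, 2, 3, 4}"
        by (auto simp: path_graph_def)
      have edges': "E b a" "E c b" "E d c" "E e d" and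
        non': "\<not> E c a" "\<not> E d a" "\<not> E e a" "\<not> E d b" "\<not> E e b" "\<not> E e c"
        using edges non E_sym by blast+
      have ne: "distinct [a, b, c, d, e]"
        using edges edges' non non' E_irrefl by auto
      have "\<not> free_of (path_graph 5) G"
      proof (rule not_free_of_embedding[OF assms(2) pair_graph_path_graph])
        show "inj_on ?f (pverts (path_graph 5))"
          unfolding five using ne by (auto simp: inj_on_def)
        show "?f ` pverts (path_graph 5) \<subseteq> verts G"
          unfolding five using edges E_verts by auto
        have non_edges: "\<not> E a c" "\<not> E a d" "\<not> E a e" "\<not> E b d" "\<not> E b e" "\<not> E c e"
          using non by blast+
        fix x y assume "x \<in> pverts (path_graph 5)" "y \<in> pverts (path_graph 5)"
        then show "(?f x, ?f y) \<in> arcs_ends G \<longleftrightarrow> (x, y) \<in> parcs (path_graph 5)"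
          unfolding five E_def[symmetric]
          by (elim insertE emptyE)
            (simp_all add: path_graph_def edges edges' non_edges non' E_irrefl)
      qed
      with assms(4) show False by blast
    qed
  qed (use uv0 E_sym E_irrefl E_verts in auto)
  have "\<exists>c :: 'a \<Rightarrow> nat. c ` verts G \<subseteq> {..t} \<and> rainbow_vertex_connected G c"
    using dominating_clique_or_P4
  proof (elim disjE exE conjE)
    fix K0 assume K0: "clique K0" "dom K0 = verts G"
    have "\<exists>i\<in>I. \<exists>j\<in>I. E (p i) (p j)"
      if I: "clique I" "card I = t" and p: "\<And>i j. i \<in> I \<Longrightarrow> j \<in> I \<Longrightarrow> E i (p j) \<longleftrightarrow> i = j" for I p
    proof (rule ccontr)
      assume indep: "\<not> ?thesis"
      have "finite I" using I(1) by (auto simp: clique_def intro: finite_subset)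
      then obtain h where h: "bij_betw h {..<t} I"
        using ex_bij_betw_nat_finite[of I] I(2) by (auto simp: atLeast0LessThan)
      have hI: "h i \<in> I" if "i < t" for i
        using bij_betwE[OF h] that by simp
      have h_eq: "h i = h j \<longleftrightarrow> i = j" if "i < t" "j < t" for i j
        using h that by (auto simp: bij_betw_def inj_on_def)
      \<comment> \<open>Clique vertices go to \<open>I\<close>, and the leaf at \<open>Inl i\<close>
        goes to the private neighbour of \<open>h i\<close>.\<close>
      let ?f = "case_sum h (\<lambda>i. p (h i))"
      \<comment> \<open>If \<open>p i = j\<close>, the edge from \<open>j\<close> to
        \<open>p j\<close> would join two private neighbours.\<close>
      have p_notin: "p i \<noteq> j" if "i \<in> I" "j \<in> I" for i j
        using indep p that by metis
      have pverts: "pverts (complete_pendant_graph t) = Inl ` {..<t} \<union> Inr ` {..<t}"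
        by (auto simp: complete_pendant_graph_def)
      have "\<not> free_of (complete_pendant_graph t) G"
      proof (rule not_free_of_embedding[OF assms(2) pair_graph_complete_pendant_graph])
        have p_eq: "p (h i) = p (h j) \<longleftrightarrow> i = j" if "i < t" "j < t" for i j
          using p[OF hI hI] h_eq that by metis
        have ph_ne: "p (h i) \<noteq> h j" "h j \<noteq> p (h i)" if "i < t" "j < t" for i j
          using p_notin[OF hI hI] that by metis+
        show "inj_on ?f (pverts (complete_pendant_graph t))"
        proof (rule inj_onI)
          fix x y assume "x \<in> pverts (complete_pendant_graph t)"
            "y \<in> pverts (complete_pendant_graph t)" "?f x = ?f y"
          then show "x = y"
            unfolding pverts by (auto simp: h_eq p_eq ph_ne)
        qed
        have "h i \<in> verts G" "p (h i) \<in> verts G" if "i < t" for i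
          using p[OF hI[OF that] hI[OF that]] E_verts by blast+
        then show "?f ` pverts (complete_pendant_graph t) \<subseteq> verts G"
          unfolding pverts by auto
        fix x y assume xy: "x \<in> pverts (complete_pendant_graph t)" "y \<in> pverts (complete_pendant_graph t)"
        have hh: "E (h i) (h j) \<longleftrightarrow> i \<noteq> j" if "i < t" "j < t" for i j
          using cliqueD[OF I(1) hI hI] h_eq E_irrefl that by metis
        have hp: "E (h i) (p (h j)) \<longleftrightarrow> i = j" "E (p (h j)) (h i) \<longleftrightarrow> i = j" if "i < t" "j < t" for i j
          using p[OF hI hI] h_eq E_sym that by metis+
        have pp: "\<not> E (p (h i)) (p (h j))" if "i < t" "j < t" for i j
          using indep hI that by blast
        show "(?f x, ?f y) \<in> arcs_ends G \<longleftrightarrow> (x, y) \<in> parcs (complete_pendant_graph t)"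
          unfolding E_def[symmetric] using xy unfolding pverts
          by (auto simp: complete_pendant_graph_def hh hp pp)
      qed
      with assms(5) show False by blast
    qed
    then obtain c :: "'a \<Rightarrow> nat" where c: "c ` verts G \<subseteq> {..t}" and
      far: "\<And>u v. \<lbrakk>u \<in> verts G; v \<in> verts G; u \<noteq> v\<rbrakk> \<Longrightarrow> E u v \<or>
        (\<exists>m. E u m \<and> E m v) \<or> (\<exists>r s. E u r \<and> E r s \<and> E s v \<and> c r \<noteq> c s)"
      using dominating_clique_colouring[OF K0, of t] assms(1) by force
    have "\<exists>p. joins G u p v \<and> vertex_rainbow c p" if uv: "u \<in> verts G" "v \<in> verts G" "u \<noteq> v" for u v
    proof -
      have walk: "joins G u p v" if "set (vwalk_arcs p) \<subseteq> {(x, y). E x y}" "distinct p"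
        "hd p = u" "last p = v" "p \<noteq> []" "set p \<subseteq> verts G" for p
        using that by (auto simp: joins_def vpath_def vwalk_def E_def)
      consider "E u v" | m where "E u m" "E m v"
        | r s where "\<not> E u v" "\<And>m. E u m \<Longrightarrow> \<not> E m v" "E u r" "E r s" "E s v" "c r \<noteq> c s"
        using far[OF uv] by blast
      then show ?thesis
      proof cases
        case 1
        then have "joins G u [u, v] v" using uv by (intro walk) auto
        then show ?thesis by (force simp: vertex_rainbow_def)
      next
        case (2 m)
        then have "joins G u [u, m, v] v" using uv E_irrefl E_verts[of u m] by (intro walk) auto
        then show ?thesis by (force simp: vertex_rainbow_def)
      next
        case (3 r s)
        then have "joins G u [u, r, s, v] v"
          using uv E_irrefl E_verts[of r s] by (intro walk) auto
        moreover have "vertex_rainbow c [u, r, s, v]" using 3 by (simp add: vertex_rainbow_def)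
        ultimately show ?thesis by blast
      qed
    qed
    with c show ?thesis unfolding rainbow_vertex_connected_def by blast
  next
    fix w v z d assume path: "E w v" "E v z" "E z d" and dom: "dom {w, v, z, d} = verts G"
    let ?X = "{w, v, z, d}"
    obtain h where h: "bij_betw h ?X {0..<card ?X}"
      using ex_bij_betw_finite_nat[of ?X] by blast
    have "card ?X \<le> 4" by (simp add: card_insert_if)
    then have h_less: "h x < t" if "x \<in> ?X" for x
      using bij_betwE[OF h] that assms(1) by fastforce
    \<comment> \<open>Colour 0 may be reused off the dominating path: those vertices are never
      internal to the chosen paths.\<close>
    define c where "c x = (if x \<in> ?X then h x else 0)" for x
    have X: "?X \<subseteq> verts G" using path E_verts by blast
    have "rainbow_vertex_connected G c"
    proof (rule rainbow_connected_dominating_set[OF assms(2) X])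
      show "inj_on c ?X" using h by (simp add: bij_betw_def c_def inj_on_def)
      interpret H: wf_digraph "G \<restriction> ?X" by (rule G.wellformed_induce_subgraph)
      have edge: "x \<rightarrow>\<^sup>*\<^bsub>G \<restriction> ?X\<^esub> y" if "x \<in> ?X" "y \<in> ?X" "E x y" for x y
        using that by (intro H.reachable_adjI) (auto simp: E_def arcs_ends_def arc_to_ends_def)
      have to_z: "x \<rightarrow>\<^sup>*\<^bsub>G \<restriction> ?X\<^esub> z \<and> z \<rightarrow>\<^sup>*\<^bsub>G \<restriction> ?X\<^esub> x" if "x \<in> ?X" for x
      proof -
        have "x = z \<or> x = v \<or> x = d \<or> x = w" using that by blast
        moreover have "z \<rightarrow>\<^sup>*\<^bsub>G \<restriction> ?X\<^esub> z" by (rule H.reachable_refl) simp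
        moreover have vz: "v \<rightarrow>\<^sup>*\<^bsub>G \<restriction> ?X\<^esub> z" "z \<rightarrow>\<^sup>*\<^bsub>G \<restriction> ?X\<^esub> v"
          using edge path E_sym by simp_all
        moreover have "d \<rightarrow>\<^sup>*\<^bsub>G \<restriction> ?X\<^esub> z" "z \<rightarrow>\<^sup>*\<^bsub>G \<restriction> ?X\<^esub> d"
          using edge path E_sym by simp_all
        moreover have wv: "w \<rightarrow>\<^sup>*\<^bsub>G \<restriction> ?X\<^esub> v" "v \<rightarrow>\<^sup>*\<^bsub>G \<restriction> ?X\<^esub> w"
          using edge path E_sym by simp_all
        moreover note H.reachable_trans[OF wv(1) vz(1)] H.reachable_trans[OF vz(2) wv(2)]
        ultimately show ?thesis by metis
      qed
      show "x \<rightarrow>\<^sup>*\<^bsub>G \<restriction> ?X\<^esub> y" if "x \<in> ?X" "y \<in> ?X" for x y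
        using H.reachable_trans to_z[OF that(1)] to_z[OF that(2)] by metis
      show "x \<in> ?X \<or> (\<exists>k\<in>?X. (k, x) \<in> arcs_ends G)" if "x \<in> verts G" for x
        using dominatedE[OF dom that] unfolding E_def by metis
    qed
    moreover have "c x \<le> t" for x
      using h_less[of x] unfolding c_def by (cases "x \<in> ?X") simp_all
    ultimately show ?thesis by blast
  qed
  then obtain c :: "'a \<Rightarrow> nat" where c: "c ` verts G \<subseteq> {..t}" "rainbow_vertex_connected G c"
    by blast
  have "rvc G \<le> card (c ` verts G)"
    using False c(2) by (auto simp: rvc_def intro!: Least_le)
  also have "\<dots> \<le> Suc t"
    using card_mono[OF _ c(1)] by simp
  finally show ?thesis using \<open>diam G > 0\<close> by linarith
qed

end
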